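(* There exists an absolute constant $C>0$ such that for every finite set $A\subset\mathbb{R}$ with $|A|\ge 2$, $$|A-A| \le C\,|\Delta(A\times A)|^{\frac{6}{7}}\,\log^{\frac{1}{7}}|A|,$$ where $\Delta(A\times A)$ is the set of (squared) distances spanned by $A\times A$. Equivalently, writing $D=A-A$, there exists an absolute constant $C'>0$ such that for every such $A$, $$|D| \le C'\,|D^{2}+D^{2}|^{\frac{6}{7}}\,\log^{\frac{1}{7}}|D|.$$
   Context: For finite sets $X,Y\subset\mathbb{R}$: $|X|$ is the cardinality, $X-Y=\{x-y: x\in X,\ y\in Y\}$, $X+Y=\{x+y: x\in X,\ y\in Y\}$, and $X^2=\{x^2: x\in X\}$ is the set of squares of elements of $X$ (not the product set). $\log^{c} n$ means $(\log n)^{c}$. For a finite point set $\mathcal{P}\subset\mathbb{R}^2$, the set of squares of distances spanned by $\mathcal{P}$ is $$\Delta(\mathcal{P})=\{(p_1-q_1)^2+(p_2-q_2)^2 : (p_1,p_2),(q_1,q_2)\in\mathcal{P}\}$$ (the case of equal points is allowed, so $0\in\Delta(\mathcal{P})$ if $\mathcal{P}\neq\emptyset$). In particular $\Delta(A\times A)=(A-A)^2+(A-A)^2 = D^2+D^2$. *)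

theory Defs
  imports Complex_Main "HOL-Library.Set_Algebras"
begin

text \<open>
  On sets, \<open>X - Y\<close> is the set-theoretic difference, and \<open>X ^ 2\<close> is the product set
  \<open>X * X\<close>, so the pointwise difference set and the set of squares get their own names.
  The sumset is the library's \<open>X + Y\<close>.
\<close>

definition diffset :: "real set \<Rightarrow> real set \<Rightarrow> real set" where
  "diffset X Y = {x - y | x y. x \<in> X \<and> y \<in> Y}"

definition squares :: "real set \<Rightarrow> real set" where
  "squares X = {x\<^sup>2 | x. x \<in> X}"

text \<open>The two points may coincide, so \<open>0\<close> belongs to the set whenever \<open>P\<close> is nonempty.\<close>

definition sq_distances :: "(real \<times> real) set \<Rightarrow> real set" where
  "sq_distances P = {(p1 - q1)\<^sup>2 + (p2 - q2)\<^sup>2 | p1 p2 q1 q2. (p1, p2) \<in> P \<and> (q1, q2) \<in> P}"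

end

theory Submission
  imports Defs "HOL-Analysis.Harmonic_Numbers"
begin

text \<open>
  Let \<open>D = A - A\<close>, let \<open>S\<close> be the set of squares of elements of \<open>D\<close>, so that the set of distances is
  \<open>S + S\<close>, and let \<open>P\<close> be the set of nonzero elements of \<open>S\<close>. The proof plays two estimates for the
  product set \<open>P P\<close> against each other.

  The product set is small: the identity
  \<open>2 (a - d) (c - b) = (a - b)\<^sup>2 + (c - d)\<^sup>2 - (a - c)\<^sup>2 - (b - d)\<^sup>2\<close>
  puts twice the product of any two elements of \<open>D\<close> into \<open>2S - 2S\<close>. The Pluennecke--Ruzsa inequality
  therefore bounds \<open>|P P|\<close> by \<open>|S + S|\<^sup>4 / |S|\<^sup>3\<close>. It is obtained by Petridis's method: choose
  \<open>X \<subseteq> S\<close> minimising \<open>|X + S| / |X|\<close>, and add \<open>S\<close> to \<open>X + S\<close> at the cost of this same ratio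
  (lemma \<open>petridis\<close>).

  The product set is large: Solymosi's inequality (lemma \<open>solymosi\<close>) says that
  \<open>|P|\<^sup>4 \<le> 4 (1 + ln |P|) |P + P|\<^sup>2 |P P|\<close> for positive reals.
  By Cauchy--Schwarz the product set is large if few pairs of points of \<open>P \<times> P\<close> lie on a common line
  through the origin. Adding the points on one such line to those on the next one gives points
  of \<open>(P + P) \<times> (P + P)\<close> strictly between the two lines, and hence there cannot be many rich lines.

  Eliminating \<open>|P P|\<close> gives \<open>|P|\<^sup>7 \<le> 4 (1 + ln |P|) |S + S|\<^sup>6\<close>, and \<open>|D| = 2 |P| + 1\<close>.
\<close>

section \<open>Sumset inequalities of Petridis, Pluennecke and Ruzsa\<close>

lemma card_translate:
  fixes X :: "'a::ab_group_add set"
  shows "card ((\<lambda>x. x + c) ` X) = card X"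
  by (rule card_image) (auto simp: inj_on_def)

text \<open>
  Induction on \<open>C\<close>. A new element \<open>c\<close> adds to \<open>X + S + C\<close> at most the translates by \<open>c\<close> of the points
  of \<open>X + S\<close> outside \<open>Z + S\<close>, where \<open>Z\<close> collects those \<open>x\<close> whose whole block \<open>x + S + c\<close> was there
  before. The minimality hypothesis, applied to \<open>Z\<close>, bounds the number of these points by
  \<open>K (|X| - |Z|)\<close>. On the other side \<open>X + C\<close> grows by at least \<open>|X| - |Z|\<close>, because \<open>x + c \<in> X + C\<close>
  forces \<open>x \<in> Z\<close>.
\<close>

lemma petridis:
  fixes X S C :: "'a::ab_group_add set" and K :: real
  assumes fin: "finite X" "finite S" "finite C"
    and total: "real (card (X + S)) = K * card X"
    and minimal: "\<And>Z. Z \<subseteq> X \<Longrightarrow> K * card Z \<le> card (Z + S)"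
    and K: "0 \<le> K"
  shows "real (card (X + S + C)) \<le> K * card (X + C)"
  using fin(3)
proof (induction C rule: finite_induct)
  case empty
  then show ?case by simp
next
  case (insert c C)
  define Z where "Z = {x \<in> X. (\<lambda>s. x + s + c) ` S \<subseteq> X + S + C}"
  define W where "W = {x \<in> X. x + c \<in> X + C}"
  have "W \<subseteq> Z"
  proof
    fix x assume "x \<in> W"
    then obtain y d where x: "x \<in> X" and yd: "y \<in> X" "d \<in> C" "x + c = y + d"
      unfolding W_def by (auto elim: set_plus_elim)
    have "x + s + c \<in> X + S + C" if "s \<in> S" for s
    proof -
      have "x + s + c = y + s + d" using yd(3) by (metis add.assoc add.commute)
      moreover have "y + s + d \<in> X + S + C" using yd(1,2) that by (intro set_plus_intro)
      ultimately show ?thesis by (simp only:)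
    qed
    then show "x \<in> Z" using x unfolding Z_def by auto
  qed
  have ZX: "Z \<subseteq> X" unfolding Z_def by auto
  have finZ: "finite Z" using ZX fin(1) finite_subset by auto
  have fin_XSC: "finite (X + S + C)" and fin_XS: "finite (X + S)" and fin_XC: "finite (X + C)"
    using fin insert.hyps by (auto intro!: finite_set_plus)
  have "X + S + insert c C \<subseteq> (X + S + C) \<union> (\<lambda>x. x + c) ` ((X + S) - (Z + S))"
  proof
    fix v assume "v \<in> X + S + insert c C"
    then obtain u d where ud: "u \<in> X + S" "d \<in> insert c C" "v = u + d" 
      by (auto elim!: set_plus_elim)
    show "v \<in> (X + S + C) \<union> (\<lambda>x. x + c) ` ((X + S) - (Z + S))"
    proof (cases "d \<in> C")
      case True
      then show ?thesis using ud by auto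
    next
      case False
      then have d: "d = c" using ud by simp
      show ?thesis
      proof (cases "u \<in> Z + S")
        case True
        then obtain z s where "z \<in> Z" "s \<in> S" "u = z + s" by (auto elim: set_plus_elim)
        then show ?thesis using ud(3) d unfolding Z_def by auto
      next
        case False
        then show ?thesis using ud d by auto
      qed
    qed
  qed
  then have "card (X + S + insert c C)
      \<le> card ((X + S + C) \<union> (\<lambda>x. x + c) ` ((X + S) - (Z + S)))"
    by (intro card_mono) (use fin_XSC fin_XS in auto)
  also have "\<dots> \<le> card (X + S + C) + card ((X + S) - (Z + S))"
    by (metis card_Un_le card_translate)
  also have "card ((X + S) - (Z + S)) = card (X + S) - card (Z + S)"
    using finZ fin(2) by (intro card_Diff_subset finite_set_plus set_plus_mono2 ZX order_refl)
  finally have "real (card (X + S + insert c C)) \<le> card (X + S + C) + (real (card (X + S)) - card (Z + S))"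
    using card_mono[OF fin_XS, of "Z + S"] ZX by (simp add: of_nat_diff set_plus_mono2)
  also have "\<dots> \<le> K * card (X + C) + (K * card X - K * card Z)"
    using insert.IH total minimal[OF ZX] by linarith
  also have "\<dots> = K * (real (card (X + C)) + (real (card X) - card Z))"
    by (simp add: algebra_simps)
  also have "\<dots> \<le> K * card (X + insert c C)"
  proof (rule mult_left_mono[OF _ K])
    have "(X + C) \<union> (\<lambda>x. x + c) ` (X - Z) \<subseteq> X + insert c C"
      by (auto elim!: set_plus_elim)
    moreover have "(X + C) \<inter> (\<lambda>x. x + c) ` (X - Z) = {}"
      using \<open>W \<subseteq> Z\<close> unfolding W_def by auto
    ultimately have "card (X + C) + card (X - Z) \<le> card (X + insert c C)"
      using fin fin_XC insert.hyps card_translate[of c "X - Z"]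
      by (metis card_Un_disjoint card_mono finite_Diff finite_imageI finite_insert finite_set_plus)
    moreover have "card (X - Z) = card X - card Z" "card Z \<le> card X"
      using ZX finZ fin by (auto intro: card_Diff_subset card_mono)
    ultimately show "real (card (X + C)) + (real (card X) - card Z) \<le> card (X + insert c C)"
      by linarith
  qed
  finally show ?case .
qed

text \<open>
  Ruzsa's triangle inequality: after a representation \<open>u - v\<close> is fixed for each difference,
  the pair \<open>(x + u, x + v)\<close> determines first \<open>u - v\<close>, hence \<open>u\<close> and \<open>v\<close>, and then \<open>x\<close>.
\<close>

lemma ruzsa_triangle:
  fixes X U :: "'a::ab_group_add set"
  assumes fin: "finite X" "finite U"
  shows "card X * card ((\<lambda>(u, v). u - v) ` (U \<times> U)) \<le> (card (X + U))\<^sup>2"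
proof -
  let ?d = "\<lambda>(u, v). u - v :: 'a"
  let ?r = "inv_into (U \<times> U) ?d"
  let ?f = "\<lambda>(x, w). (x + fst (?r w), x + snd (?r w))"
  have r: "fst (?r w) \<in> U" "snd (?r w) \<in> U" "fst (?r w) - snd (?r w) = w"
    if "w \<in> ?d ` (U \<times> U)" for w
    using inv_into_into[OF that] f_inv_into_f[OF that]
    by (auto simp: mem_Times_iff case_prod_unfold)
  have "inj_on ?f (X \<times> ?d ` (U \<times> U))"
  proof (rule inj_onI)
    fix z z' assume z: "z \<in> X \<times> ?d ` (U \<times> U)" "z' \<in> X \<times> ?d ` (U \<times> U)" and eq: "?f z = ?f z'"
    obtain x w x' w' where zz: "z = (x, w)" "z' = (x', w')" by fastforce
    have w: "w \<in> ?d ` (U \<times> U)" and w': "w' \<in> ?d ` (U \<times> U)" using z unfolding zz by blast+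
    have e1: "x + fst (?r w) = x' + fst (?r w')" and e2: "x + snd (?r w) = x' + snd (?r w')"
      using eq unfolding zz by simp_all
    have "w = w'"
      using r(3)[OF w] r(3)[OF w'] e1 e2 by (metis add_diff_cancel_left)
    then show "z = z'" using e1 unfolding zz by simp
  qed
  moreover have "?f ` (X \<times> ?d ` (U \<times> U)) \<subseteq> (X + U) \<times> (X + U)"
    using r(1,2) by (auto simp del: split_paired_all intro!: set_plus_intro)
  ultimately have "card (X \<times> ?d ` (U \<times> U)) \<le> card ((X + U) \<times> (X + U))"
    using fin by (intro card_inj_on_le) (auto intro!: finite_set_plus)
  then show ?thesis by (simp add: card_cartesian_product power2_eq_square)
qed

text \<open>
  Write \<open>K\<close> for the least ratio \<open>|X + S| / |X|\<close> over nonempty \<open>X \<subseteq> S\<close>. Petridis's lemma with \<open>C = S\<close>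
  bounds \<open>|X + 2S|\<close> by \<open>K\<^sup>2 |X|\<close>, and Ruzsa's triangle inequality through \<open>X\<close> turns this into
  \<open>|2S - 2S| \<le> K\<^sup>4 |X|\<close>. Finally \<open>K \<le> |S + S| / |S|\<close>, since \<open>S\<close> itself competes in the minimum.
\<close>

lemma pluennecke_ruzsa:
  fixes S :: "'a::ab_group_add set"
  assumes fin: "finite S" and ne: "S \<noteq> {}"
  shows "card ((\<lambda>(u, v). u - v) ` ((S + S) \<times> (S + S))) * card S ^ 3 \<le> card (S + S) ^ 4"
proof -
  let ?ratio = "\<lambda>X. real (card (X + S)) / card X"
  let ?F = "{X. X \<subseteq> S \<and> X \<noteq> {}}"
  have finF: "finite ?F" using fin by simp
  obtain X where X: "X \<in> ?F" and min: "\<And>Z. Z \<in> ?F \<Longrightarrow> ?ratio X \<le> ?ratio Z"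
    using ex_is_arg_min_if_finite[OF finF, of ?ratio] ne
    unfolding is_arg_min_linorder by auto
  define K where "K = ?ratio X"
  have finX: "finite X" and X0: "card X > 0" and S0: "card S > 0" and XS: "card X \<le> card S"
    using X fin by (auto intro: finite_subset simp: card_gt_0_iff card_mono)
  have K0: "0 \<le> K" unfolding K_def by simp
  have total: "real (card (X + S)) = K * card X"
    unfolding K_def using X0 by simp
  have minimal: "K * card Z \<le> card (Z + S)" if "Z \<subseteq> X" for Z
  proof (cases "Z = {}")
    case False
    then have "Z \<in> ?F" "card Z > 0" using that X finX by (auto simp: card_gt_0_iff finite_subset)
    then show ?thesis using min[of Z] unfolding K_def[symmetric] by (simp add: pos_le_divide_eq)
  qed simp
  have "real (card (X + (S + S))) = card (X + S + S)" by (simp add: add.assoc)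
  also have "\<dots> \<le> K * card (X + S)"
    by (rule petridis[OF finX fin fin total minimal K0])
  also have "\<dots> = K\<^sup>2 * card X" using total by (simp add: power2_eq_square)
  finally have two_S: "real (card (X + (S + S))) \<le> K\<^sup>2 * card X" .
  let ?D = "(\<lambda>(u, v). u - v) ` ((S + S) \<times> (S + S))"
  have "real (card X) * card ?D \<le> (real (card (X + (S + S))))\<^sup>2"
    using ruzsa_triangle[OF finX, of "S + S"] fin finite_set_plus
    by (metis of_nat_le_iff of_nat_mult of_nat_power)
  also have "\<dots> \<le> (K\<^sup>2 * card X)\<^sup>2"
    by (rule power_mono[OF two_S]) simp
  also have "\<dots> = card X * (K ^ 4 * card X)" by (simp add: power_mult_distrib power2_eq_square power4_eq_xxxx)
  finally have "card ?D \<le> K ^ 4 * card X" using X0 by simp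
  also have "\<dots> \<le> K ^ 4 * card S" using XS K0 by (intro mult_left_mono) auto
  finally have "card ?D * real (card S) ^ 3 \<le> K ^ 4 * card S * real (card S) ^ 3"
    by (rule mult_right_mono) simp
  also have "\<dots> = (K * card S) ^ 4" by (simp add: power_mult_distrib eval_nat_numeral)
  also have "\<dots> \<le> real (card (S + S)) ^ 4"
  proof (rule power_mono)
    have "K \<le> ?ratio S" using min[of S] ne unfolding K_def by auto
    then show "K * card S \<le> card (S + S)" using S0 by (simp add: pos_le_divide_eq)
  qed (use K0 in simp)
  finally show ?thesis
    by (metis of_nat_le_iff of_nat_mult of_nat_power)
qed

section \<open>Solymosi's lower bound for the product set\<close>

text \<open>
  For a set \<open>P\<close> of positive numbers these are the points of \<open>P \<times> P\<close> on the line through the origin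
  of slope \<open>s\<close>, that is, the representations of \<open>s\<close> as a quotient of elements of \<open>P\<close>.
\<close>

definition line_points :: "real set \<Rightarrow> real \<Rightarrow> (real \<times> real) set" where
  "line_points P s = {p \<in> P \<times> P. snd p / fst p = s}"

lemma card_line_points_le:
  assumes "finite P" "P \<subseteq> {0<..}"
  shows "card (line_points P s) \<le> card P"
proof (rule card_inj_on_le[OF _ _ assms(1)])
  show "inj_on fst (line_points P s)"
    using assms(2) by (auto simp: inj_on_def line_points_def divide_simps dest!: subsetD)
  show "fst ` line_points P s \<subseteq> P"
    by (auto simp: line_points_def)
qed

text \<open>
  The sums of a point on one line and a point on another determine both summands, since two vectors
  of different slopes are linearly independent, and their slopes lie strictly between the two.
\<close>

lemma card_sums_between_lines:
  assumes P: "finite P" "P \<subseteq> {0<..}" and "s < m"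
  shows "card (line_points P s) * card (line_points P m)
    \<le> card {w \<in> (P + P) \<times> (P + P). s < snd w / fst w \<and> snd w / fst w < m}"
proof -
  let ?f = "\<lambda>(p, q). (fst p + fst q, snd p + snd q) :: real \<times> real"
  have on_line: "fst p \<in> P \<and> snd p \<in> P \<and> fst p > 0 \<and> snd p = k * fst p"
    if "p \<in> line_points P k" for p k
    using that P(2) by (auto simp: line_points_def)
  have "inj_on ?f (line_points P s \<times> line_points P m)"
  proof (rule inj_onI)
    fix z z' assume z: "z \<in> line_points P s \<times> line_points P m"
      and z': "z' \<in> line_points P s \<times> line_points P m" and eq: "?f z = ?f z'"
    obtain p q p' q' where zz: "z = (p, q)" "z' = (p', q')" by (metis surj_pair)
    have l: "snd p = s * fst p" "snd q = m * fst q" "snd p' = s * fst p'" "snd q' = m * fst q'"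
      using z z' zz on_line by blast+
    have e: "fst p + fst q = fst p' + fst q'" "snd p + snd q = snd p' + snd q'"
      using eq zz by auto
    (* Eliminating the second coordinates leaves a multiple of the unknown fst p - fst p'. *)
    have "(m - s) * (fst p - fst p') = m * (fst p + fst q) - m * (fst p' + fst q')
        - ((s * fst p + m * fst q) - (s * fst p' + m * fst q'))"
      by (simp add: algebra_simps)
    also have "\<dots> = 0" using e l by simp
    finally have "fst p = fst p'" using \<open>s < m\<close> by simp
    then show "z = z'" using e l zz by (auto simp: prod_eq_iff)
  qed
  moreover have "?f ` (line_points P s \<times> line_points P m)
      \<subseteq> {w \<in> (P + P) \<times> (P + P). s < snd w / fst w \<and> snd w / fst w < m}"
  proof (rule image_subsetI)
    fix z assume z: "z \<in> line_points P s \<times> line_points P m"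
    obtain p q where zz: "z = (p, q)" by (metis surj_pair)
    have p: "fst p \<in> P" "snd p \<in> P" "fst p > 0" "snd p = s * fst p"
      and q: "fst q \<in> P" "snd q \<in> P" "fst q > 0" "snd q = m * fst q"
      using z zz on_line by blast+
    have "s * fst q < m * fst q" "s * fst p < m * fst p" using \<open>s < m\<close> p(3) q(3) by auto
    then have "s < (snd p + snd q) / (fst p + fst q)" "(snd p + snd q) / (fst p + fst q) < m"
      using p q by (auto simp: pos_less_divide_eq pos_divide_less_eq algebra_simps)
    then show "?f z \<in> {w \<in> (P + P) \<times> (P + P). s < snd w / fst w \<and> snd w / fst w < m}"
      using p q zz by (auto intro!: set_plus_intro)
  qed
  ultimately have "card (line_points P s \<times> line_points P m)
      \<le> card {w \<in> (P + P) \<times> (P + P). s < snd w / fst w \<and> snd w / fst w < m}"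
    by (rule card_inj_on_le)
      (use finite_set_plus[OF P(1) P(1)] in \<open>auto intro: finite_subset[of _ "(P + P) \<times> (P + P)"]\<close>)
  then show ?thesis by (simp add: card_cartesian_product)
qed

text \<open>
  The open sectors between consecutive lines are disjoint, so every line after the first
  contributes at least \<open>t\<^sup>2\<close> new points.
\<close>

lemma card_sums_below_max_slope:
  assumes P: "finite P" "P \<subseteq> {0<..}" and "finite L" "L \<noteq> {}"
    and "\<And>s. s \<in> L \<Longrightarrow> t \<le> card (line_points P s)"
  shows "(card L - 1) * t\<^sup>2 \<le> card {w \<in> (P + P) \<times> (P + P). snd w / fst w < Max L}"
  using assms(3-5)
proof (induction L rule: finite_linorder_max_induct)
  case empty
  then show ?case by simp
next
  case (insert m L)
  show ?case
  proof (cases "L = {}")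
    case False
    define s where "s = Max L"
    let ?G = "(P + P) \<times> (P + P)"
    let ?old = "{w \<in> ?G. snd w / fst w < s}"
    let ?new = "{w \<in> ?G. s < snd w / fst w \<and> snd w / fst w < m}"
    have sL: "s \<in> L" unfolding s_def using insert.hyps(1) False by simp
    then have sm: "s < m" using insert.hyps(2) by simp
    have fin: "finite ?G" using P(1) by (auto intro: finite_set_plus)
    have max: "Max (insert m L) = m"
      unfolding Max_insert[OF insert.hyps(1) False] s_def[symmetric] using sm by simp
    have card_L: "card (insert m L) - 1 = (card L - 1) + 1"
      using insert.hyps False by (subst card_insert_disjoint) (auto simp: Suc_le_eq card_gt_0_iff)
    have "t * t \<le> card (line_points P s) * card (line_points P m)"
      using insert.prems(2) sL by (intro mult_le_mono) auto
    also have "\<dots> \<le> card ?new" by (rule card_sums_between_lines[OF P sm])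
    finally have "t\<^sup>2 \<le> card ?new" by (simp add: power2_eq_square)
    moreover have "(card L - 1) * t\<^sup>2 \<le> card ?old"
      unfolding s_def using insert.IH insert.prems(2) False by blast
    ultimately have "(card (insert m L) - 1) * t\<^sup>2 \<le> card ?old + card ?new"
      unfolding card_L by (simp add: algebra_simps)
    also have "\<dots> = card (?old \<union> ?new)"
      using fin by (intro card_Un_disjoint[symmetric]) auto
    also have "\<dots> \<le> card {w \<in> ?G. snd w / fst w < Max (insert m L)}"
      unfolding max using fin sm by (intro card_mono) auto
    finally show ?thesis .
  qed simp
qed

text \<open>
  For a single line the bound of the preceding lemma is trivial, and \<open>t \<le> |P| \<le> |P + P|\<close> takes its
  place.
\<close>

lemma card_rich_lines:
  assumes P: "finite P" "P \<subseteq> {0<..}" and L: "finite L"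
    and rich: "\<And>s. s \<in> L \<Longrightarrow> t \<le> card (line_points P s)"
  shows "card L * t\<^sup>2 \<le> 2 * (card (P + P))\<^sup>2"
proof -
  let ?M = "card (P + P)"
  consider "L = {}" | "card L = 1" | "card L \<ge> 2"
    using L by (metis One_nat_def Suc_1 card_eq_0_iff le_antisym not_less_eq_eq le0)
  then show ?thesis
  proof cases
    case 1
    then show ?thesis by simp
  next
    case 2
    then obtain s where "s \<in> L" by (metis card_1_singletonE singletonI)
    then have t: "t \<le> card (line_points P s)" using rich by blast
    also have "\<dots> \<le> card P" by (rule card_line_points_le[OF P])
    also have "card P \<le> ?M"
    proof (cases "P = {}")
      case False
      then obtain c where c: "c \<in> P" by blast
      have "card ((\<lambda>x. x + c) ` P) \<le> ?M"
        using c P(1) by (intro card_mono finite_set_plus) auto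
      then show ?thesis by (simp add: card_translate)
    qed simp
    finally have "t\<^sup>2 \<le> ?M\<^sup>2" by (simp add: power_mono)
    then show ?thesis unfolding 2 by linarith
  next
    case 3
    have fin: "finite ((P + P) \<times> (P + P))" using P(1) by (auto intro: finite_set_plus)
    have "card L * t\<^sup>2 \<le> 2 * ((card L - 1) * t\<^sup>2)"
      unfolding mult.assoc[symmetric] using 3 by (intro mult_right_mono) auto
    also have "(card L - 1) * t\<^sup>2 \<le> card {w \<in> (P + P) \<times> (P + P). snd w / fst w < Max L}"
      using 3 by (intro card_sums_below_max_slope[OF P L] rich) auto
    also have "\<dots> \<le> card ((P + P) \<times> (P + P))" by (rule card_mono[OF fin]) auto
    also have "\<dots> = ?M\<^sup>2" by (simp add: card_cartesian_product power2_eq_square)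
    finally show ?thesis by simp
  qed
qed

lemma sum_card_fibres_squared:
  assumes "finite B"
  shows "(\<Sum>y\<in>f ` B. (card {p \<in> B. f p = y})\<^sup>2) = card {(p, q) \<in> B \<times> B. f p = f q}"
proof -
  have "{(p, q) \<in> B \<times> B. f p = f q} = (\<Union>y\<in>f ` B. {p \<in> B. f p = y} \<times> {p \<in> B. f p = y})"
    by auto
  also have "card \<dots> = (\<Sum>y\<in>f ` B. card ({p \<in> B. f p = y} \<times> {p \<in> B. f p = y}))"
    using assms by (intro card_UN_disjoint) auto
  finally show ?thesis by (simp add: card_cartesian_product power2_eq_square)
qed

text \<open>Cauchy--Schwarz for the fibres of \<open>f\<close>.\<close>

lemma card_squared_le_image_times_collisions:
  assumes "finite B"
  shows "(card B)\<^sup>2 \<le> card (f ` B) * card {(p, q) \<in> B \<times> B. f p = f q}"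
proof -
  have "B = (\<Union>y\<in>f ` B. {p \<in> B. f p = y})" by auto
  then have "card B = card (\<Union>y\<in>f ` B. {p \<in> B. f p = y})" by simp
  also have "\<dots> = (\<Sum>y\<in>f ` B. card {p \<in> B. f p = y})"
    using assms by (intro card_UN_disjoint) auto
  finally have "(real (card B))\<^sup>2 = (\<Sum>y\<in>f ` B. 1 * real (card {p \<in> B. f p = y}))\<^sup>2"
    by simp
  also have "\<dots> \<le> (\<Sum>y\<in>f ` B. 1\<^sup>2) * (\<Sum>y\<in>f ` B. (real (card {p \<in> B. f p = y}))\<^sup>2)"
    by (rule Cauchy_Schwarz_ineq_sum)
  also have "\<dots> = real (card (f ` B) * (\<Sum>y\<in>f ` B. (card {p \<in> B. f p = y})\<^sup>2))"
    by simp
  finally show ?thesis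
    unfolding sum_card_fibres_squared[OF assms] of_nat_power[symmetric] of_nat_le_iff .
qed

text \<open>
  Multiplicative energy may be counted by products or by quotients: \<open>a b = c d\<close> says the same as
  \<open>a / c = d / b\<close>.
\<close>

lemma card_product_collisions_eq_quotient_collisions:
  fixes P :: "real set"
  assumes "P \<subseteq> {0<..}"
  shows "card {(p, q) \<in> (P \<times> P) \<times> (P \<times> P). fst p * snd p = fst q * snd q}
    = card {(p, q) \<in> (P \<times> P) \<times> (P \<times> P). snd p / fst p = snd q / fst q}"
proof (rule bij_betw_same_card)
  let ?g = "\<lambda>((a, b), (c, d)). ((c, a), (b, d)) :: (real \<times> real) \<times> (real \<times> real)"
  let ?h = "\<lambda>((c, a), (b, d)). ((a, b), (c, d)) :: (real \<times> real) \<times> (real \<times> real)"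
  have nz: "x \<noteq> 0" if "x \<in> P" for x using that assms by auto
  show "bij_betw ?g {(p, q) \<in> (P \<times> P) \<times> (P \<times> P). fst p * snd p = fst q * snd q}
      {(p, q) \<in> (P \<times> P) \<times> (P \<times> P). snd p / fst p = snd q / fst q}"
    by (rule bij_betw_byWitness[where f' = ?h]) (auto simp: frac_eq_eq nz mult.commute)
qed

lemma harm_le_one_plus_ln:
  assumes "n \<ge> 1"
  shows "harm n \<le> 1 + ln (real n)"
proof -
  obtain k where k: "n = Suc k" using assms by (cases n) auto
  show ?thesis
    using decseqD[OF decseq_harm_diff_ln, of 0 k] k by (simp add: harm_expand)
qed

text \<open>
  The energy is the sum of \<open>r\<^sup>2\<close> over the lines, \<open>r\<close> being the number of points on the line. Writing
  \<open>r\<^sup>2\<close> as the sum of \<open>2 t - 1\<close> over \<open>t \<le> r\<close> and exchanging the summations reduces the estimate to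
  counting lines with at least \<open>t\<close> points; the bounds for these counts add up to a harmonic sum.
\<close>

lemma quotient_collisions_le:
  fixes P :: "real set"
  assumes P: "finite P" "P \<subseteq> {0<..}" "P \<noteq> {}"
  shows "card {(p, q) \<in> (P \<times> P) \<times> (P \<times> P). snd p / fst p = snd q / fst q}
    \<le> 4 * (real (card (P + P)))\<^sup>2 * (1 + ln (card P))"
proof -
  let ?f = "\<lambda>p :: real \<times> real. snd p / fst p"
  let ?n = "card P"
  let ?r = "\<lambda>s. card (line_points P s)"
  let ?M = "real (card (P + P))"
  define Sl where "Sl = ?f ` (P \<times> P)"
  have finSl: "finite Sl" unfolding Sl_def using P(1) by simp
  have square: "(real m)\<^sup>2 = (\<Sum>t = 1..m. 2 * real t - 1)" for m
    by (induction m) (auto simp: power2_eq_square algebra_simps)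
  have layers: "(real (?r s))\<^sup>2 = (\<Sum>t = 1..?n. if t \<le> ?r s then 2 * real t - 1 else 0)" for s
  proof -
    have "{t \<in> {1..?n}. t \<le> ?r s} = {1..?r s}"
      using card_line_points_le[OF P(1,2), of s] by auto
    then show ?thesis unfolding square by (simp add: sum.inter_filter[symmetric])
  qed
  have "real (card {(p, q) \<in> (P \<times> P) \<times> (P \<times> P). ?f p = ?f q}) = (\<Sum>s\<in>Sl. (real (?r s))\<^sup>2)"
    using sum_card_fibres_squared[of "P \<times> P" ?f] P(1)
    unfolding Sl_def line_points_def by (simp flip: of_nat_power of_nat_sum)
  also have "\<dots> = (\<Sum>t = 1..?n. \<Sum>s\<in>Sl. if t \<le> ?r s then 2 * real t - 1 else 0)"
    unfolding layers by (rule sum.swap)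
  also have "\<dots> = (\<Sum>t = 1..?n. (2 * real t - 1) * card {s \<in> Sl. t \<le> ?r s})"
    using finSl by (intro sum.cong) (auto simp: sum.inter_filter[symmetric])
  also have "\<dots> \<le> (\<Sum>t = 1..?n. 4 * ?M\<^sup>2 * inverse (real t))"
  proof (rule sum_mono)
    fix t assume "t \<in> {1..?n}"
    then have t: "real t > 0" by simp
    let ?N = "card {s \<in> Sl. t \<le> ?r s}"
    have "?N * t\<^sup>2 \<le> 2 * (card (P + P))\<^sup>2"
      using finSl by (intro card_rich_lines[OF P(1,2)]) auto
    then have "real (?N * t\<^sup>2) \<le> real (2 * (card (P + P))\<^sup>2)" by (rule of_nat_mono)
    then have N: "real ?N * (real t)\<^sup>2 \<le> 2 * ?M\<^sup>2" by simp
    have "(2 * real t - 1) * ?N * t \<le> 2 * real t * ?N * t"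
      by (intro mult_right_mono) auto
    also have "\<dots> \<le> 4 * ?M\<^sup>2" using N by (simp add: power2_eq_square algebra_simps)
    finally show "(2 * real t - 1) * ?N \<le> 4 * ?M\<^sup>2 * inverse (real t)"
      using t by (simp add: field_simps)
  qed
  also have "\<dots> = 4 * ?M\<^sup>2 * harm ?n" by (simp add: harm_def sum_distrib_left)
  also have "\<dots> \<le> 4 * ?M\<^sup>2 * (1 + ln ?n)"
    using P by (intro mult_left_mono harm_le_one_plus_ln) (auto simp: Suc_le_eq card_gt_0_iff)
  finally show ?thesis .
qed

lemma solymosi:
  fixes P :: "real set"
  assumes P: "finite P" "P \<subseteq> {0<..}" "P \<noteq> {}"
  shows "real (card P) ^ 4 \<le> 4 * (1 + ln (card P)) * real (card (P + P)) ^ 2 * card (P * P)"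
proof -
  let ?E = "card {(p, q) \<in> (P \<times> P) \<times> (P \<times> P). fst p * snd p = fst q * snd q}"
  have "(\<lambda>p. fst p * snd p) ` (P \<times> P) = P * P"
    unfolding set_times_image by (simp add: case_prod_unfold)
  then have "(card (P \<times> P))\<^sup>2 \<le> card (P * P) * ?E"
    using card_squared_le_image_times_collisions[of "P \<times> P" "\<lambda>p. fst p * snd p"] P(1) by simp
  then have "(card P) ^ 4 \<le> card (P * P) * ?E"
    by (simp add: card_cartesian_product power2_eq_square power4_eq_xxxx mult.assoc)
  then have "real (card P ^ 4) \<le> real (card (P * P) * ?E)" by (rule of_nat_mono)
  then have "real (card P) ^ 4 \<le> card (P * P) * real ?E" by simp
  also have "\<dots> \<le> card (P * P) * (4 * (real (card (P + P)))\<^sup>2 * (1 + ln (card P)))"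
    unfolding card_product_collisions_eq_quotient_collisions[OF P(2)]
    by (rule mult_left_mono[OF quotient_collisions_le[OF P]]) simp
  finally show ?thesis by (simp only: mult_ac)
qed

section \<open>Differences and distances\<close>

lemma sq_distances_Times: "sq_distances (A \<times> A) = squares (diffset A A) + squares (diffset A A)"
proof
  show "sq_distances (A \<times> A) \<subseteq> squares (diffset A A) + squares (diffset A A)"
    unfolding sq_distances_def squares_def diffset_def by (auto intro!: set_plus_intro)
  show "squares (diffset A A) + squares (diffset A A) \<subseteq> sq_distances (A \<times> A)"
    unfolding sq_distances_def squares_def diffset_def by (fastforce elim!: set_plus_elim)
qed

lemma finite_diffset: "finite X \<Longrightarrow> finite Y \<Longrightarrow> finite (diffset X Y)"
  unfolding diffset_def by (simp add: finite_image_set2)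

lemma finite_squares: "finite X \<Longrightarrow> finite (squares X)"
  unfolding squares_def by (simp add: finite_image_set)

lemma double_product_mem_double_squares:
  assumes "x \<in> diffset A A" "y \<in> diffset A A"
  defines "S \<equiv> squares (diffset A A)"
  shows "2 * x * y \<in> (\<lambda>(u, v). u - v) ` ((S + S) \<times> (S + S))"
proof -
  obtain a b c d where A: "a \<in> A" "b \<in> A" "c \<in> A" "d \<in> A" and xy: "x = a - d" "y = c - b"
    using assms(1,2) unfolding diffset_def by blast
  have S: "(u - v)\<^sup>2 \<in> S" if "u \<in> A" "v \<in> A" for u v
    using that unfolding S_def squares_def diffset_def by blast
  have "2 * x * y = ((a - b)\<^sup>2 + (c - d)\<^sup>2) - ((a - c)\<^sup>2 + (b - d)\<^sup>2)"
    unfolding xy by (simp add: power2_eq_square algebra_simps)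
  moreover have "(a - b)\<^sup>2 + (c - d)\<^sup>2 \<in> S + S" "(a - c)\<^sup>2 + (b - d)\<^sup>2 \<in> S + S"
    using S A by auto
  ultimately show ?thesis by auto
qed

text \<open>
  Doubling the square root is injective and sends a product of two squares of differences into
  \<open>2S - 2S\<close>: the product \<open>x\<^sup>2 y\<^sup>2\<close> goes to \<open>2 |x y|\<close>, and since \<open>A - A\<close> is symmetric
  this is twice a product of two of its elements.
\<close>

lemma card_products_of_squares_le:
  assumes "finite A" and P: "P \<subseteq> squares (diffset A A)"
  defines "S \<equiv> squares (diffset A A)"
  shows "card (P * P) \<le> card ((\<lambda>(u, v). u - v) ` ((S + S) \<times> (S + S)))"
proof (rule card_inj_on_le)
  show "inj_on (\<lambda>z. 2 * sqrt z) (P * P)" by (simp add: inj_on_def)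
  show "finite ((\<lambda>(u, v). u - v) ` ((S + S) \<times> (S + S)))"
    unfolding S_def using assms(1)
    by (intro finite_imageI finite_cartesian_product finite_set_plus finite_squares finite_diffset)
  show "(\<lambda>z. 2 * sqrt z) ` (P * P) \<subseteq> (\<lambda>(u, v). u - v) ` ((S + S) \<times> (S + S))"
  proof (rule image_subsetI)
    fix z assume "z \<in> P * P"
    then obtain p q where "p \<in> P" "q \<in> P" "z = p * q" by (auto elim: set_times_elim)
    then obtain x y where xy: "x \<in> diffset A A" "y \<in> diffset A A" "z = x\<^sup>2 * y\<^sup>2"
      using P unfolding squares_def by blast
    have minus: "- x \<in> diffset A A"
      using xy(1) unfolding diffset_def by (smt (verit) mem_Collect_eq)
    have "2 * sqrt z = 2 * \<bar>x\<bar> * \<bar>y\<bar>" using xy(3) by (simp add: real_sqrt_mult)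
    then have "2 * sqrt z = 2 * x * y \<or> 2 * sqrt z = 2 * (- x) * y"
      by (auto simp: abs_if)
    then show "2 * sqrt z \<in> (\<lambda>(u, v). u - v) ` ((S + S) \<times> (S + S))"
      using double_product_mem_double_squares[OF xy(1,2)]
        double_product_mem_double_squares[OF minus xy(2)]
      unfolding S_def by metis
  qed
qed

lemma card_diffset_ge_3:
  assumes "finite A" "card A \<ge> 2"
  shows "card (diffset A A) \<ge> 3"
proof -
  obtain a b where ab: "a \<in> A" "b \<in> A" "a \<noteq> b"
    using assms by (metis card_le_Suc0_iff_eq not_less_eq_eq numeral_2_eq_2)
  have "a - a \<in> diffset A A" "a - b \<in> diffset A A" "b - a \<in> diffset A A"
    using ab unfolding diffset_def by blast+
  then have "card {a - a, a - b, b - a} \<le> card (diffset A A)"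
    by (intro card_mono finite_diffset assms) auto
  moreover have "card {a - a, a - b, b - a} = 3" using ab(3) by auto
  ultimately show ?thesis by simp
qed

lemma card_diffset_le:
  assumes "finite A"
  shows "card (diffset A A) \<le> (card A)\<^sup>2"
proof -
  have "diffset A A = (\<lambda>(x, y). x - y) ` (A \<times> A)" unfolding diffset_def by auto
  then show ?thesis
    using card_image_le[of "A \<times> A" "\<lambda>(x, y). x - y"] assms
    by (simp add: card_cartesian_product power2_eq_square)
qed

lemma card_le_card_squares:
  assumes "finite D"
  shows "card D \<le> 1 + 2 * card (squares D - {0})"
proof -
  let ?P = "squares D - {0}"
  have fin: "finite ?P" using assms finite_squares by simp
  have "D \<subseteq> {0} \<union> (sqrt ` ?P \<union> (\<lambda>z. - sqrt z) ` ?P)"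
  proof
    fix x assume "x \<in> D"
    then have "x = 0 \<or> x\<^sup>2 \<in> ?P" unfolding squares_def by auto
    moreover have "x = sqrt (x\<^sup>2) \<or> x = - sqrt (x\<^sup>2)" by (simp add: abs_if)
    ultimately show "x \<in> {0} \<union> (sqrt ` ?P \<union> (\<lambda>z. - sqrt z) ` ?P)" by blast
  qed
  then have "card D \<le> card ({0} \<union> (sqrt ` ?P \<union> (\<lambda>z. - sqrt z) ` ?P))"
    using fin by (intro card_mono) auto
  also have "\<dots> \<le> card {0::real} + (card (sqrt ` ?P) + card ((\<lambda>z. - sqrt z) ` ?P))"
    by (intro order_trans[OF card_Un_le] add_mono card_Un_le) auto
  also have "\<dots> \<le> 1 + (card ?P + card ?P)"
    using fin by (intro add_mono card_image_le) auto
  finally show ?thesis by simp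
qed

text \<open>
  With \<open>n = |P|\<close>, \<open>N = |S|\<close> and \<open>M = |S + S|\<close> the two bounds read
  \<open>n\<^sup>4 \<le> 4 (1 + ln n) M\<^sup>2 |P P|\<close> and \<open>|P P| N\<^sup>3 \<le> M\<^sup>4\<close>; their product and \<open>n \<le> N\<close> give the seventh power.
\<close>

lemma card_diffset_pow7_le:
  assumes A: "finite A" "card A \<ge> 2"
  defines "D \<equiv> diffset A A"
  shows "real (card D) ^ 7 \<le> 8 * 3 ^ 7 * real (card (squares D + squares D)) ^ 6 * ln (card D)"
proof -
  define S where "S = squares D"
  define P where "P = S - {0}"
  define n N M Q where "n = real (card P)" and "N = real (card S)"
    and "M = real (card (S + S))" and "Q = real (card (P * P))"
  have finD: "finite D" and finS: "finite S" and finP: "finite P"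
    using A by (auto simp: D_def S_def P_def finite_diffset finite_squares)
  have D3: "card D \<ge> 3" unfolding D_def by (rule card_diffset_ge_3[OF A])
  have Dn: "card D \<le> 1 + 2 * card P"
    unfolding P_def S_def by (rule card_le_card_squares[OF finD])
  have Ppos: "P \<subseteq> {0<..}" unfolding P_def S_def squares_def by auto
  have P1: "card P \<ge> 1" using D3 Dn by linarith
  have Pne: "P \<noteq> {}" using P1 by auto
  then have Sne: "S \<noteq> {}" unfolding P_def by auto
  have n1: "n \<ge> 1" using P1 unfolding n_def by simp
  have nN: "n \<le> N" unfolding n_def N_def P_def using finS by (simp add: card_mono)
  have nD: "card P \<le> card D"
  proof -
    have "card P \<le> card S" unfolding P_def using finS by (intro card_mono) auto
    also have "S = (\<lambda>x. x\<^sup>2) ` D" unfolding S_def squares_def by auto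
    also have "card \<dots> \<le> card D" by (rule card_image_le[OF finD])
    finally show ?thesis .
  qed
  have "card (P * P) * card S ^ 3 \<le> card ((\<lambda>(u, v). u - v) ` ((S + S) \<times> (S + S))) * card S ^ 3"
    using card_products_of_squares_le[OF A(1), of P] unfolding S_def D_def P_def by simp
  also have "\<dots> \<le> card (S + S) ^ 4" by (rule pluennecke_ruzsa[OF finS Sne])
  finally have "real (card (P * P) * card S ^ 3) \<le> real (card (S + S) ^ 4)" by (rule of_nat_mono)
  then have upper: "Q * N ^ 3 \<le> M ^ 4" unfolding Q_def N_def M_def by simp
  have "card (P + P) \<le> card (S + S)"
    unfolding P_def using finS by (intro card_mono finite_set_plus set_plus_mono2) auto
  then have PM: "real (card (P + P)) \<le> M" unfolding M_def by simp
  define H where "H = 1 + ln n"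
  have H0: "H \<ge> 0" unfolding H_def using n1 by simp
  have "n ^ 4 \<le> 4 * H * real (card (P + P)) ^ 2 * Q"
    using solymosi[OF finP Ppos Pne] unfolding n_def H_def Q_def by simp
  also have "\<dots> \<le> 4 * H * M ^ 2 * Q"
    using PM H0 by (intro mult_right_mono mult_left_mono power_mono) (auto simp: Q_def)
  finally have lower: "n ^ 4 \<le> 4 * H * M ^ 2 * Q" .
  have "n ^ 7 = n ^ 4 * n ^ 3" by (simp flip: power_add)
  also have "\<dots> \<le> (4 * H * M ^ 2 * Q) * N ^ 3"
    using lower nN n1 H0 by (intro mult_mono power_mono) (auto simp: Q_def)
  also have "\<dots> = 4 * H * M ^ 2 * (Q * N ^ 3)" by simp
  also have "\<dots> \<le> 4 * H * M ^ 2 * M ^ 4"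
    using upper H0 by (intro mult_left_mono) auto
  also have "\<dots> = 4 * M ^ 6 * H" by (simp flip: power_add)
  also have "\<dots> \<le> 4 * M ^ 6 * (2 * ln (card D))"
  proof (rule mult_left_mono)
    (* The constant term of 1 + ln n is absorbed because card D is at least 3 > e. *)
    have "exp 1 \<le> real (card D)" using D3 exp_le by linarith
    then have "1 \<le> ln (real (card D))" using D3 by (subst ln_ge_iff) auto
    moreover have "ln n \<le> ln (card D)" unfolding n_def using nD P1 by simp
    ultimately show "H \<le> 2 * ln (card D)" unfolding H_def by linarith
  qed simp
  finally have n7: "n ^ 7 \<le> 8 * M ^ 6 * ln (card D)" by simp
  have "real (card D) ^ 7 \<le> (3 * n) ^ 7"
    using Dn n1 unfolding n_def by (intro power_mono) auto
  also have "\<dots> \<le> 3 ^ 7 * (8 * M ^ 6 * ln (card D))"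
    using n7 unfolding power_mult_distrib by (intro mult_left_mono) auto
  finally show ?thesis unfolding M_def S_def by (simp only: mult_ac)
qed

lemma seventh_root_bound:
  fixes x M L K :: real
  assumes "x ^ 7 \<le> K * M ^ 6 * L" "x \<ge> 0" "K \<ge> 0" "M \<ge> 0" "L \<ge> 0"
  shows "x \<le> K powr (1 / 7) * M powr (6 / 7) * L powr (1 / 7)"
proof (rule power_le_imp_le_base)
  have pow7: "(a powr (1 / 7)) ^ 7 = a" if "a \<ge> 0" for a :: real
    using that by (cases "a = 0") (simp_all add: powr_power)
  have "(M powr (6 / 7)) ^ 7 = M ^ 6"
    using assms(4) by (cases "M = 0") (simp_all add: powr_power)
  then show "x ^ Suc 6 \<le> (K powr (1 / 7) * M powr (6 / 7) * L powr (1 / 7)) ^ Suc 6"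
    using assms pow7 by (simp add: power_mult_distrib)
qed (use assms in simp)

theorem theorem2:
  shows "(\<exists>C>0. \<forall>A :: real set. finite A \<and> card A \<ge> 2 \<longrightarrow>
            real (card (diffset A A))
              \<le> C * real (card (sq_distances (A \<times> A))) powr (6 / 7) * ln (real (card A)) powr (1 / 7))
       \<and> (\<exists>C'>0. \<forall>A :: real set. finite A \<and> card A \<ge> 2 \<longrightarrow>
            (let D = diffset A A in
              real (card D)
                \<le> C' * real (card (squares D + squares D)) powr (6 / 7) * ln (real (card D)) powr (1 / 7)))"
proof (intro conjI)
  show "\<exists>C>0. \<forall>A :: real set. finite A \<and> card A \<ge> 2 \<longrightarrow>
            real (card (diffset A A))
              \<le> C * real (card (sq_distances (A \<times> A))) powr (6 / 7) * ln (real (card A)) powr (1 / 7)"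
  proof (intro exI[of _ "(16 * 3 ^ 7) powr (1 / 7)"] conjI allI impI)
    fix A :: "real set"
    assume A: "finite A \<and> card A \<ge> 2"
    let ?D = "diffset A A"
    let ?M = "real (card (sq_distances (A \<times> A)))"
    have D3: "card ?D \<ge> 3" using A card_diffset_ge_3 by blast
    (* Replacing card D by card A inside the logarithm costs only a factor 2. *)
    have "ln (real (card ?D)) \<le> ln (real ((card A)\<^sup>2))"
      using card_diffset_le[of A] A D3 by (intro ln_mono) linarith+
    also have "\<dots> = 2 * ln (real (card A))" using A by (simp add: ln_realpow)
    finally have log: "ln (real (card ?D)) \<le> 2 * ln (real (card A))" .
    have "real (card ?D) ^ 7 \<le> 8 * 3 ^ 7 * ?M ^ 6 * ln (card ?D)"
      using card_diffset_pow7_le A unfolding sq_distances_Times by blast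
    also have "\<dots> \<le> 8 * 3 ^ 7 * ?M ^ 6 * (2 * ln (card A))"
      using log by (intro mult_left_mono) auto
    finally have "real (card ?D) ^ 7 \<le> (16 * 3 ^ 7) * ?M ^ 6 * ln (card A)" by simp
    then show "real (card ?D) \<le> (16 * 3 ^ 7) powr (1 / 7) * ?M powr (6 / 7) * ln (card A) powr (1 / 7)"
      using A by (intro seventh_root_bound) auto
  qed simp
  show "\<exists>C'>0. \<forall>A :: real set. finite A \<and> card A \<ge> 2 \<longrightarrow>
            (let D = diffset A A in
              real (card D)
                \<le> C' * real (card (squares D + squares D)) powr (6 / 7) * ln (real (card D)) powr (1 / 7))"
    unfolding Let_def
  proof (intro exI[of _ "(8 * 3 ^ 7) powr (1 / 7)"] conjI allI impI)
    fix A :: "real set"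
    assume A: "finite A \<and> card A \<ge> 2"
    let ?D = "diffset A A"
    let ?M = "real (card (squares ?D + squares ?D))"
    have D3: "card ?D \<ge> 3" using A card_diffset_ge_3 by blast
    have "real (card ?D) ^ 7 \<le> (8 * 3 ^ 7) * ?M ^ 6 * ln (card ?D)"
      using card_diffset_pow7_le A by blast
    then show "real (card ?D) \<le> (8 * 3 ^ 7) powr (1 / 7) * ?M powr (6 / 7) * ln (card ?D) powr (1 / 7)"
      using D3 by (intro seventh_root_bound) auto
  qed simp
qed

end
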